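(* Let $h$ and $F$ be as in the context, let $x^\star\in\operatorname{argmin}_x h(F(x))$ and $z^\star=F(x^\star)$. Suppose: $h$ is $(\mu,L)$-regular (nonsmooth sense) for $F$ with unique minimizer $z^\star$ over $\operatorname{Im}F$; $\nabla F$ is locally Lipschitz at $x^\star$ with radius $\varepsilon_{\nabla F}$ and constant $L_{\nabla F}$; and $F$ is locally weakly aligned at $x^\star$ with functions $\delta,s$ and radius $\varepsilon_{x^\star}$. Let $\varepsilon=\min\{\varepsilon_{\nabla F},\varepsilon_{x^\star}\}$. Let $\gamma>0$ and $0<C_{\mathtt{lb}}\le C_{\mathtt{ub}}$ satisfy $\gamma\le\min\left\{1,\frac{C_{\mathtt{lb}}}{L_{\nabla F}}\right\}$ and $C_{\mathtt{ub}}\le\frac{\mu}{8L}\,s\left(\frac{\mu}{8L}\right)$, and define $\tilde q=\sqrt{1-\frac{\gamma\mu^2}{8L^2}}$. Let $x_0$ and $z_0=F(x_0)$ satisfy $$\|x_0-x^\star\|\le\varepsilon/2\qquad\text{and}\qquad\|z_0-z^\star\|\le\min\left\{\delta\left(\frac{\mu}{8L}\right),\frac{(1-\sqrt{\tilde q})^2\varepsilon^2C_{\mathtt{lb}}}{2\gamma^2}\right\}.$$ Suppose $(x_k)_{k\ge0}$ is generated by the LMM subgradient method started at $x_0$ with the Polyak configuration with parameters $\gamma,C_{\mathtt{lb}},C_{\mathtt{ub}}$. Then $$\|x_k-x^\star\|<\varepsilon\quad\text{for all }k\ge0,$$ and, moreover, $z_k=F(x_k)$ satisfies $$\|z_k-z^\star\|^2\le\left(1-\frac{\gamma\mu^2}{8L^2}\right)^k\|z_0-z^\star\|^2\quad\text{for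 all }k\ge0.$$
   Context: Setting. $\mathbf{E},\mathbf{Y}$ are finite-dimensional Euclidean spaces with inner products $\langle\cdot,\cdot\rangle$ and induced norms $\|\cdot\|$; $h:\mathbf{Y}\to\mathbb{R}$ is convex and $F:\mathbf{E}\to\mathbf{Y}$ is continuously differentiable. $\nabla F(x):\mathbf{E}\to\mathbf{Y}$ is the derivative (Jacobian) and $\nabla F(x)^\top$ its adjoint. $\partial h$ is the convex subdifferential. $\mathbb{R}_+$ denotes the positive reals, $B_r(z)$ the closed ball of radius $r$, and $1/0=+\infty$. $h^\star$ and $\mathcal{Z}^\star$ are the minimum value and the set of minimizers of $h$ over $\operatorname{Im}F$. $\Pi^x$ is the orthogonal projection onto the range of $\nabla F(x)$. Fix for each $x$ an SVD of $\nabla F(x)$ with singular values $\sigma^x_1\ge\sigma^x_2\ge\cdots$; $\Pi^x_j$ is the orthogonal projection onto the span of the top $j$ left singular vectors. For $\lambda>0$, $P(x,\lambda)=\nabla F(x)(\nabla F(x)^\top\nabla F(x)+\lambda I)^{-1}\nabla F(x)^\top$. LMM (Levenberg-Morrison-Marquardt) subgradient method. Given $x_0\in\mathbf{E}$, stepsizes $\gamma_k>0$ and damping coefficients $\lambda_k>0$: for $k\ge0$ pick any $v_k\in\partial h(F(x_k))$ and set $x_{k+1}=x_k-\gamma_k(\nabla F(x_k)^\top\nabla F(x_k)+\lambda_kI)^{-1}\nabla F(x_k)^\top v_k$. Write $z_k=F(x_k)$. Polyak configuration with parameters $\gamma>0$, $0<C_{\mathtt{lb}}\le C_{\mathtt{ub}}$: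 $\gamma_k=\gamma\frac{h(z_k)-h^\star}{\|\Pi^{x_k}v_k\|^2}$ and $C_{\mathtt{lb}}\operatorname{dist}(z_k,\mathcal{Z}^\star)\le\lambda_k\le C_{\mathtt{ub}}\operatorname{dist}(z_k,\mathcal{Z}^\star)$ for all $k$. $\nabla F$ is locally Lipschitz at $x^\star$ with radius $\varepsilon_{\nabla F}>0$ and constant $L_{\nabla F}\ge0$: $\|\nabla F(x)-\nabla F(y)\|_{\mathrm{op}}\le L_{\nabla F}\|x-y\|$ for all $x,y\in B_{\varepsilon_{\nabla F}}(x^\star)$. $F$ is locally weakly aligned at $x^\star$ (with $z^\star=F(x^\star)$) with functions $\delta,s:\mathbb{R}_+\to\mathbb{R}_+$ and radius $\varepsilon_{x^\star}>0$: for all $\rho>0$, if $x\in B_{\varepsilon_{x^\star}}(x^\star)$ and $z=F(x)\in B_{\delta(\rho)}(z^\star)$, then there is an index $j$ with $\|(I-\Pi^x_j)(z-z^\star)\|\le\rho\|z-z^\star\|$ and $(\sigma^x_j)^2\ge s(\rho)\|z-z^\star\|$. $h$ is $(\mu,L)$-regular (nonsmooth sense) for $F$ ($\mu,L>0$): (1) $h$ has a unique minimizer $z^\star$ over $\operatorname{Im}F$; (2) $h$ is convex; (3) $h(z)-h^\star\ge\mu\|z-z^\star\|$ for all $z\in\operatorname{Im}F$; (4a) $\|\Pi^xv\|\le L$ for all $x\in\mathbf{E}$ and $v\in\partial h(F(x))$; (4b) for all $x\in\mathbf{E}$, $z=F(x)$, $v\in\partial h(F(x))$ and $\lambda>0$,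 $|\langle v,(I-P(x,\lambda))(z-z^\star)\rangle|\le L\|(I-P(x,\lambda))(z-z^\star)\|$. *)

theory Defs
  imports "HOL-Analysis.Analysis"
begin

definition subdiff :: "('b::euclidean_space \<Rightarrow> real) \<Rightarrow> 'b \<Rightarrow> 'b set" where
  "subdiff h z = {v. \<forall>y. h y \<ge> h z + v \<bullet> (y - z)}"

definition minimizers :: "('b \<Rightarrow> real) \<Rightarrow> ('a \<Rightarrow> 'b) \<Rightarrow> 'b set" where
  "minimizers h F = {z. is_arg_min h (\<lambda>w. w \<in> range F) z}"

text \<open>The infimum is the minimum value as soon as a minimizer exists; an infimum that is not
  attained or not finite plays no role.\<close>

definition min_val :: "('b \<Rightarrow> real) \<Rightarrow> ('a \<Rightarrow> 'b) \<Rightarrow> real" where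
  "min_val h F = (INF z \<in> range F. h z)"

definition orth_proj :: "'b::euclidean_space set \<Rightarrow> 'b \<Rightarrow> 'b" where
  "orth_proj S y = (THE p. p \<in> S \<and> (\<forall>s\<in>S. (y - p) \<bullet> s = 0))"

text \<open>For linear \<open>A\<close> and \<open>lam > 0\<close> the map inverted here is a bijection, so \<open>inv\<close> is
  its genuine inverse.\<close>

definition reg_inv :: "('a::euclidean_space \<Rightarrow> 'b::euclidean_space) \<Rightarrow> real \<Rightarrow> 'a \<Rightarrow> 'a" where
  "reg_inv A lam = inv (\<lambda>u. adjoint A (A u) + lam *\<^sub>R u)"

definition damped_proj :: "('a::euclidean_space \<Rightarrow> 'b::euclidean_space) \<Rightarrow> real \<Rightarrow> 'b \<Rightarrow> 'b" where
  "damped_proj A lam y = A (reg_inv A lam (adjoint A y))"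

text \<open>A full singular value decomposition, with indices starting at 1: \<open>u\<close> and \<open>v\<close> are
  orthonormal bases of the codomain and of the domain, and there are
  \<open>min DIM('a) DIM('b)\<close> singular values, zero values included.\<close>

definition is_svd ::
  "('a::euclidean_space \<Rightarrow> 'b::euclidean_space) \<Rightarrow> (nat \<Rightarrow> real) \<Rightarrow> (nat \<Rightarrow> 'b) \<Rightarrow> (nat \<Rightarrow> 'a) \<Rightarrow> bool"
where
  "is_svd A \<sigma> u v \<longleftrightarrow>
     (\<forall>i\<in>{1..DIM('b)}. \<forall>j\<in>{1..DIM('b)}. u i \<bullet> u j = (if i = j then 1 else 0)) \<and>
     (\<forall>i\<in>{1..DIM('a)}. \<forall>j\<in>{1..DIM('a)}. v i \<bullet> v j = (if i = j then 1 else 0)) \<and>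
     (\<forall>i\<in>{1..min DIM('a) DIM('b)}. 0 \<le> \<sigma> i) \<and>
     (\<forall>i\<in>{1..min DIM('a) DIM('b)}. \<forall>j\<in>{1..min DIM('a) DIM('b)}. i \<le> j \<longrightarrow> \<sigma> j \<le> \<sigma> i) \<and>
     (\<forall>x. A x = (\<Sum>i=1..min DIM('a) DIM('b). (\<sigma> i * (v i \<bullet> x)) *\<^sub>R u i))"

text \<open>\<open>\<sigma> x\<close> and \<open>u x\<close> are the singular values and left singular vectors of the derivative
  of \<open>F\<close> at \<open>x\<close>.\<close>

definition locally_weakly_aligned ::
  "('a::euclidean_space \<Rightarrow> 'b::euclidean_space) \<Rightarrow> ('a \<Rightarrow> nat \<Rightarrow> real) \<Rightarrow> ('a \<Rightarrow> nat \<Rightarrow> 'b) \<Rightarrow>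
   'a \<Rightarrow> (real \<Rightarrow> real) \<Rightarrow> (real \<Rightarrow> real) \<Rightarrow> real \<Rightarrow> bool"
where
  "locally_weakly_aligned F \<sigma> u xstar \<delta> s r \<longleftrightarrow>
     r > 0 \<and> (\<forall>\<rho>>0. \<delta> \<rho> > 0 \<and> s \<rho> > 0) \<and>
     (\<forall>\<rho>>0. \<forall>x. x \<in> cball xstar r \<and> F x \<in> cball (F xstar) (\<delta> \<rho>) \<longrightarrow>
        (\<exists>j\<in>{1..min DIM('a) DIM('b)}.
           norm ((F x - F xstar) - orth_proj (span (u x ` {1..j})) (F x - F xstar))
             \<le> \<rho> * norm (F x - F xstar) \<and>
           (\<sigma> x j)\<^sup>2 \<ge> s \<rho> * norm (F x - F xstar)))"

definition nonsmooth_regular ::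
  "('b::euclidean_space \<Rightarrow> real) \<Rightarrow> ('a::euclidean_space \<Rightarrow> 'b) \<Rightarrow> ('a \<Rightarrow> 'a \<Rightarrow>\<^sub>L 'b) \<Rightarrow>
   'b \<Rightarrow> real \<Rightarrow> real \<Rightarrow> bool"
where
  "nonsmooth_regular h F DF zstar \<mu> L \<longleftrightarrow>
     \<mu> > 0 \<and> L > 0 \<and>
     minimizers h F = {zstar} \<and>
     convex_on UNIV h \<and>
     (\<forall>z\<in>range F. h z - min_val h F \<ge> \<mu> * norm (z - zstar)) \<and>
     (\<forall>x. \<forall>v\<in>subdiff h (F x). norm (orth_proj (range (DF x)) v) \<le> L) \<and>
     (\<forall>x. \<forall>v\<in>subdiff h (F x). \<forall>lam>0.
        \<bar>v \<bullet> ((F x - zstar) - damped_proj (DF x) lam (F x - zstar))\<bar>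
          \<le> L * norm ((F x - zstar) - damped_proj (DF x) lam (F x - zstar)))"

definition lmm_subgradient ::
  "('b::euclidean_space \<Rightarrow> real) \<Rightarrow> ('a::euclidean_space \<Rightarrow> 'b) \<Rightarrow> ('a \<Rightarrow> 'a \<Rightarrow>\<^sub>L 'b) \<Rightarrow>
   (nat \<Rightarrow> real) \<Rightarrow> (nat \<Rightarrow> real) \<Rightarrow> (nat \<Rightarrow> 'b) \<Rightarrow> (nat \<Rightarrow> 'a) \<Rightarrow> bool"
where
  "lmm_subgradient h F DF step damp v x \<longleftrightarrow>
     (\<forall>k. step k > 0 \<and> damp k > 0 \<and> v k \<in> subdiff h (F (x k)) \<and>
        x (Suc k) = x k - step k *\<^sub>R reg_inv (DF (x k)) (damp k) (adjoint (DF (x k)) (v k)))"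

text \<open>A vanishing denominator yields step 0 here, which \<open>lmm_subgradient\<close> excludes, just as
  the step \<open>+\<infinity>\<close> is not a legitimate stepsize.\<close>

definition polyak_config ::
  "('b::euclidean_space \<Rightarrow> real) \<Rightarrow> ('a::euclidean_space \<Rightarrow> 'b) \<Rightarrow> ('a \<Rightarrow> 'a \<Rightarrow>\<^sub>L 'b) \<Rightarrow>
   real \<Rightarrow> real \<Rightarrow> real \<Rightarrow>
   (nat \<Rightarrow> real) \<Rightarrow> (nat \<Rightarrow> real) \<Rightarrow> (nat \<Rightarrow> 'b) \<Rightarrow> (nat \<Rightarrow> 'a) \<Rightarrow> bool"
where
  "polyak_config h F DF \<gamma> Clb Cub step damp v x \<longleftrightarrow>
     (\<forall>k. step k = \<gamma> * ((h (F (x k)) - min_val h F)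
                        / (norm (orth_proj (range (DF (x k))) (v k)))\<^sup>2) \<and>
          Clb * infdist (F (x k)) (minimizers h F) \<le> damp k \<and>
          damp k \<le> Cub * infdist (F (x k)) (minimizers h F))"

end

theory Submission
  imports Defs
begin

text \<open>
  One step moves \<open>x\<close> by \<open>- t d\<close>, where \<open>t\<close> is the stepsize and \<open>d\<close> the damped
  least-squares direction for the subgradient \<open>v\<close>.  To first order the image error
  \<open>e = F x - zstar\<close> becomes \<open>e - t P v\<close> with \<open>P\<close> the damped projection onto the range of
  the derivative: a Polyak subgradient step for \<open>h\<close> in which \<open>v\<close> is replaced by \<open>P v\<close>.
  Two things have to be controlled.

  First, replacing \<open>v\<close> by \<open>P v\<close> must not destroy the angle with \<open>e\<close>.  Since \<open>P\<close> is
  self-adjoint, \<open>P v \<bullet> e = v \<bullet> e - v \<bullet> (e - P e)\<close>.  Along the \<open>i\<close>-th left singular vector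
  the residual map \<open>I - P\<close> multiplies by \<open>lam / ((\<sigma> i)\<^sup>2 + lam)\<close>.  Weak alignment says that
  \<open>e\<close> lies, up to a relative error \<open>\<rho>\<close>, in a top singular space in which
  \<open>(\<sigma> i)\<^sup>2\<close> is at least \<open>s \<rho> * norm e\<close>, and the upper bound on the damping makes
  \<open>lam \<le> \<rho> * s \<rho> * norm e\<close>.  Hence \<open>e - P e\<close> has norm at most \<open>2 * \<rho> * norm e\<close>
  (\<open>damped_residual_of_aligned\<close>); for \<open>\<rho> = \<mu> / (8 * L)\<close> and by sharpness of \<open>h\<close> this
  costs at most a quarter of the gap in function value.

  Second, the step must be short enough for the linearization to be trusted.  The energy identity
  for the normal equations bounds \<open>lam * norm d ^ 2\<close> by a quarter of the squared norm of the
  projected subgradient (\<open>norm_reg_inv_le\<close>).  As \<open>lam\<close> is at least \<open>Clb * norm e\<close>, the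
  squared step length is of order \<open>norm e\<close>, and the linearization error is at most half of
  the decrease of the linearized step, thanks to \<open>\<gamma> * L_DF \<le> Clb\<close>.

  Together (\<open>polyak_step_estimates\<close>) these give contraction of \<open>norm e\<close> by the factor
  \<open>1 - \<gamma> * \<mu>\<^sup>2 / (8 * L\<^sup>2)\<close>, which is at most \<open>q\<close>.  The step lengths, being of order
  \<open>sqrt (norm e)\<close>, are then dominated by a geometric series of ratio \<open>sqrt q\<close>; the
  requirement on \<open>F (x 0)\<close> makes its sum less than \<open>eps / 2\<close>, so the iterates never leave the
  ball on which the estimates hold.
\<close>

section \<open>Orthogonal projections\<close>

lemma orth_proj_properties:
  fixes S :: "'b::euclidean_space set"
  assumes "subspace S"
  shows "orth_proj S y \<in> S" and "\<And>s. s \<in> S \<Longrightarrow> (y - orth_proj S y) \<bullet> s = 0"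
proof -
  obtain p r where p: "p \<in> span S" and r: "\<And>w. w \<in> span S \<Longrightarrow> orthogonal r w" and y: "y = p + r"
    using orthogonal_subspace_decomp_exists[of S y] by blast
  have S: "span S = S"
    using assms by (simp add: span_eq_iff)
  have "orth_proj S y \<in> S \<and> (\<forall>s\<in>S. (y - orth_proj S y) \<bullet> s = 0)"
    unfolding orth_proj_def
  proof (rule theI[of _ p])
    show "p \<in> S \<and> (\<forall>s\<in>S. (y - p) \<bullet> s = 0)"
      using p r y S by (auto simp: orthogonal_def)
  next
    fix p' assume p': "p' \<in> S \<and> (\<forall>s\<in>S. (y - p') \<bullet> s = 0)"
    have "p - p' \<in> S"
      using p p' S assms by (auto intro: subspace_diff)
    then have "(y - p') \<bullet> (p - p') = 0" and "(y - p) \<bullet> (p - p') = 0"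
      using p' r y S by (auto simp: orthogonal_def)
    then have "(p - p') \<bullet> (p - p') = 0"
      by (simp add: inner_diff_left)
    then show "p' = p" by simp
  qed
  then show "orth_proj S y \<in> S" and "\<And>s. s \<in> S \<Longrightarrow> (y - orth_proj S y) \<bullet> s = 0"
    by auto
qed

lemma inner_orth_proj:
  assumes "subspace S" "s \<in> S"
  shows "s \<bullet> orth_proj S y = s \<bullet> y"
  using orth_proj_properties(2)[OF assms(1), of s y] assms(2)
  by (simp add: inner_diff_left inner_commute[of s])

lemma norm_orth_proj_le:
  assumes "subspace S"
  shows "norm (orth_proj S y) \<le> norm y"
proof (cases "orth_proj S y = 0")
  case False
  have "norm (orth_proj S y) * norm (orth_proj S y) = orth_proj S y \<bullet> y"
    using inner_orth_proj[OF assms orth_proj_properties(1)[OF assms]]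
    by (metis norm_eq_sqrt_inner real_sqrt_mult_self abs_of_nonneg inner_ge_zero)
  also have "\<dots> \<le> norm (orth_proj S y) * norm y"
    by (rule norm_cauchy_schwarz)
  finally show ?thesis using False by simp
qed simp

section \<open>The damped projection\<close>

lemma reg_inv_unique_solution:
  fixes A :: "'a::euclidean_space \<Rightarrow> 'b::euclidean_space"
  assumes A: "linear A" and lam: "lam > 0"
  shows reg_inv_solves: "adjoint A (A (reg_inv A lam b)) + lam *\<^sub>R reg_inv A lam b = b"
    and reg_inv_eqI: "adjoint A (A d) + lam *\<^sub>R d = b \<Longrightarrow> reg_inv A lam b = d"
proof -
  let ?H = "\<lambda>u. adjoint A (A u) + lam *\<^sub>R u"
  have H: "linear ?H"
    using linear_compose[OF A adjoint_linear[OF A]]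
    by (intro linear_compose_add) (auto simp: o_def linear_compose_scale_right linear_id)
  have "inj ?H"
    unfolding linear_injective_0[OF H]
  proof (intro allI impI)
    fix u assume "?H u = 0"
    then have "u \<bullet> ?H u = 0" by simp
    then have "A u \<bullet> A u + lam * (u \<bullet> u) = 0"
      by (simp add: inner_add_right adjoint_works[OF A])
    then have "lam * (u \<bullet> u) = 0"
      using lam by (smt (verit) inner_ge_zero mult_nonneg_nonneg)
    then show "u = 0" using lam by simp
  qed
  moreover from this have "surj ?H"
    using linear_injective_imp_surjective[OF H] by simp
  ultimately show "adjoint A (A (reg_inv A lam b)) + lam *\<^sub>R reg_inv A lam b = b"
    and "?H d = b \<Longrightarrow> reg_inv A lam b = d"
    unfolding reg_inv_def using surj_f_inv_f[of ?H b] inv_f_eq[of ?H d b] by auto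
qed

lemma linear_reg_inv:
  fixes A :: "'a::euclidean_space \<Rightarrow> 'b::euclidean_space"
  assumes A: "linear A" and lam: "lam > 0"
  shows "linear (reg_inv A lam)"
proof (rule linearI)
  note lin = linear_add[OF A] linear_cmul[OF A]
    linear_add[OF adjoint_linear[OF A]] linear_cmul[OF adjoint_linear[OF A]]
  fix b c :: 'a and r :: real
  show "reg_inv A lam (b + c) = reg_inv A lam b + reg_inv A lam c"
    using reg_inv_solves[OF assms, of b] reg_inv_solves[OF assms, of c]
    by (intro reg_inv_eqI[OF assms]) (simp add: lin algebra_simps)
  show "reg_inv A lam (r *\<^sub>R b) = r *\<^sub>R reg_inv A lam b"
  proof (rule reg_inv_eqI[OF assms])
    let ?d = "reg_inv A lam b"
    have "adjoint A (A (r *\<^sub>R ?d)) + lam *\<^sub>R r *\<^sub>R ?d = r *\<^sub>R (adjoint A (A ?d) + lam *\<^sub>R ?d)"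
      by (simp only: lin scaleR_add_right scaleR_left_commute)
    then show "adjoint A (A (r *\<^sub>R ?d)) + lam *\<^sub>R r *\<^sub>R ?d = r *\<^sub>R b"
      by (simp only: reg_inv_solves[OF assms])
  qed
qed

lemma linear_damped_proj:
  fixes A :: "'a::euclidean_space \<Rightarrow> 'b::euclidean_space"
  assumes A: "linear A" and lam: "lam > 0"
  shows "linear (damped_proj A lam)"
proof -
  have "linear (A \<circ> reg_inv A lam \<circ> adjoint A)"
    by (intro linear_compose A adjoint_linear linear_reg_inv lam)
  moreover have "damped_proj A lam = A \<circ> reg_inv A lam \<circ> adjoint A"
    by (rule ext) (simp only: damped_proj_def o_apply)
  ultimately show ?thesis by (simp only:)
qed

lemma damped_proj_self_adjoint:
  fixes A :: "'a::euclidean_space \<Rightarrow> 'b::euclidean_space"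
  assumes A: "linear A" and lam: "lam > 0"
  shows "damped_proj A lam y \<bullet> z = y \<bullet> damped_proj A lam z"
proof -
  define d e where "d = reg_inv A lam (adjoint A y)" and "e = reg_inv A lam (adjoint A z)"
  note adj = adjoint_works[OF A]
  have d: "adjoint A (A d) + lam *\<^sub>R d = adjoint A y"
    unfolding d_def by (rule reg_inv_solves[OF assms])
  have e: "adjoint A (A e) + lam *\<^sub>R e = adjoint A z"
    unfolding e_def by (rule reg_inv_solves[OF assms])
  have "A d \<bullet> z = d \<bullet> (adjoint A (A e) + lam *\<^sub>R e)"
    by (simp add: adj e)
  also have "\<dots> = e \<bullet> (adjoint A (A d) + lam *\<^sub>R d)"
    by (simp add: inner_add_right adj inner_commute)
  also have "\<dots> = y \<bullet> A e"
    by (simp add: d adj inner_commute)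
  finally show ?thesis
    by (simp add: damped_proj_def d_def e_def)
qed

text \<open>Pair the normal equation \<open>A\<^sup>T A d + lam d = A\<^sup>T y\<close> with its solution \<open>d\<close>.\<close>

lemma damped_proj_energy:
  fixes A :: "'a::euclidean_space \<Rightarrow> 'b::euclidean_space"
  assumes A: "linear A" and lam: "lam > 0"
  shows "(norm (damped_proj A lam y))\<^sup>2 + lam * (norm (reg_inv A lam (adjoint A y)))\<^sup>2
    = damped_proj A lam y \<bullet> y"
proof -
  define d where "d = reg_inv A lam (adjoint A y)"
  have "d \<bullet> (adjoint A (A d) + lam *\<^sub>R d) = d \<bullet> adjoint A y"
    unfolding d_def by (simp add: reg_inv_solves[OF assms])
  then show ?thesis
    by (simp add: inner_add_right adjoint_works[OF A] damped_proj_def d_def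
        power2_norm_eq_inner)
qed

lemma norm_damped_residual_le:
  fixes A :: "'a::euclidean_space \<Rightarrow> 'b::euclidean_space"
  assumes A: "linear A" and lam: "lam > 0"
  shows "norm (y - damped_proj A lam y) \<le> norm y"
proof (rule power2_le_imp_le)
  have "(norm (y - damped_proj A lam y))\<^sup>2
      = (norm y)\<^sup>2 - 2 * (damped_proj A lam y \<bullet> y) + (norm (damped_proj A lam y))\<^sup>2"
    by (simp add: power2_norm_eq_inner inner_diff_left inner_diff_right inner_commute)
  moreover have "0 \<le> lam * (norm (reg_inv A lam (adjoint A y)))\<^sup>2"
    using lam by simp
  ultimately show "(norm (y - damped_proj A lam y))\<^sup>2 \<le> (norm y)\<^sup>2"
    using damped_proj_energy[OF assms, of y] zero_le_power2[of "norm (damped_proj A lam y)"]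
    by linarith
qed simp

text \<open>The damped projection takes values in the range of \<open>A\<close>, so the right-hand side of the
  energy identity only sees the projection \<open>p\<close> of \<open>y\<close> onto that range.  The second bound is
  \<open>n (m - n) \<le> m\<^sup>2 / 4\<close> for \<open>n\<close> the norm of the damped projection and \<open>m\<close> that
  of \<open>p\<close>; the factor 1/4 is what keeps the linearization error below the linear decrease.\<close>

lemma damped_proj_bounds:
  fixes A :: "'a::euclidean_space \<Rightarrow> 'b::euclidean_space"
  assumes A: "linear A" and lam: "lam > 0"
  shows norm_damped_proj_le: "norm (damped_proj A lam y) \<le> norm (orth_proj (range A) y)"
    and norm_reg_inv_le:
      "lam * (norm (reg_inv A lam (adjoint A y)))\<^sup>2 \<le> (norm (orth_proj (range A) y))\<^sup>2 / 4"
proof -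
  define n where "n = norm (damped_proj A lam y)"
  define m where "m = norm (orth_proj (range A) y)"
  define l where "l = lam * (norm (reg_inv A lam (adjoint A y)))\<^sup>2"
  have "subspace (range A)"
    using linear_subspace_image[OF A subspace_UNIV] .
  then have "damped_proj A lam y \<bullet> y = damped_proj A lam y \<bullet> orth_proj (range A) y"
    by (subst inner_orth_proj) (auto simp: damped_proj_def)
  also have "\<dots> \<le> n * m"
    unfolding n_def m_def by (rule norm_cauchy_schwarz)
  finally have E: "n\<^sup>2 + l \<le> n * m"
    using damped_proj_energy[OF assms, of y] by (simp add: n_def l_def)
  have "l \<ge> 0" using lam by (simp add: l_def)
  then have "n * n \<le> n * m"
    using E by (simp add: power2_eq_square)
  then have "n \<le> m"
    by (cases "n = 0") (auto simp: n_def m_def)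
  moreover have "l \<le> m\<^sup>2 / 4"
    using E zero_le_power2[of "n - m / 2"] by (simp add: power2_eq_square algebra_simps)
  ultimately show "norm (damped_proj A lam y) \<le> norm (orth_proj (range A) y)"
    and "lam * (norm (reg_inv A lam (adjoint A y)))\<^sup>2 \<le> (norm (orth_proj (range A) y))\<^sup>2 / 4"
    by (simp_all add: n_def m_def l_def)
qed

section \<open>Damping along singular vectors\<close>

lemma norm_sum_orthonormal:
  fixes u :: "'i \<Rightarrow> 'b::real_inner"
  assumes "finite I" "\<And>i j. i \<in> I \<Longrightarrow> j \<in> I \<Longrightarrow> u i \<bullet> u j = (if i = j then 1 else 0)"
  shows "(norm (\<Sum>i\<in>I. c i *\<^sub>R u i))\<^sup>2 = (\<Sum>i\<in>I. (c i)\<^sup>2)"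
proof -
  have "(norm (\<Sum>i\<in>I. c i *\<^sub>R u i))\<^sup>2 = (\<Sum>i\<in>I. \<Sum>j\<in>I. c i * c j * (u j \<bullet> u i))"
    by (simp add: power2_norm_eq_inner inner_sum_left inner_sum_right sum_distrib_left
        mult.assoc)
  also have "\<dots> = (\<Sum>i\<in>I. \<Sum>j\<in>I. if j = i then (c i)\<^sup>2 else 0)"
    using assms(2) by (intro sum.cong refl) (auto simp: power2_eq_square)
  also have "\<dots> = (\<Sum>i\<in>I. (c i)\<^sup>2)"
    using assms(1) by simp
  finally show ?thesis .
qed

lemma svd_singular_pair:
  fixes A :: "'a::euclidean_space \<Rightarrow> 'b::euclidean_space"
  assumes A: "linear A" and svd: "is_svd A \<sigma> u v" and i: "i \<in> {1..min DIM('a) DIM('b)}"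
  shows "A (v i) = \<sigma> i *\<^sub>R u i" and "adjoint A (u i) = \<sigma> i *\<^sub>R v i"
proof -
  let ?N = "{1..min DIM('a) DIM('b)}"
  have uu: "\<And>i j. i \<in> ?N \<Longrightarrow> j \<in> ?N \<Longrightarrow> u i \<bullet> u j = (if i = j then 1 else 0)"
    and vv: "\<And>i j. i \<in> ?N \<Longrightarrow> j \<in> ?N \<Longrightarrow> v i \<bullet> v j = (if i = j then 1 else 0)"
    and Ax: "\<And>x. A x = (\<Sum>i\<in>?N. (\<sigma> i * (v i \<bullet> x)) *\<^sub>R u i)"
    using svd unfolding is_svd_def by auto
  have "A (v i) = (\<Sum>j\<in>?N. if j = i then \<sigma> i *\<^sub>R u i else 0)"
    unfolding Ax using vv i by (intro sum.cong refl) auto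
  then show "A (v i) = \<sigma> i *\<^sub>R u i" using i by simp
  have "x \<bullet> adjoint A (u i) = x \<bullet> (\<sigma> i *\<^sub>R v i)" for x
  proof -
    have "x \<bullet> adjoint A (u i) = A x \<bullet> u i" by (rule adjoint_works[OF A])
    also have "\<dots> = (\<Sum>j\<in>?N. if j = i then \<sigma> i * (v i \<bullet> x) else 0)"
      unfolding Ax inner_sum_left using uu i by (intro sum.cong refl) auto
    also have "\<dots> = x \<bullet> (\<sigma> i *\<^sub>R v i)"
      using i by (simp add: inner_commute)
    finally show ?thesis .
  qed
  then show "adjoint A (u i) = \<sigma> i *\<^sub>R v i"
    by (rule vector_eq_ldot[THEN iffD1, OF allI])
qed

lemma damped_proj_singular_vector:
  fixes A :: "'a::euclidean_space \<Rightarrow> 'b::euclidean_space"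
  assumes A: "linear A" and lam: "lam > 0"
    and svd: "is_svd A \<sigma> u v" and i: "i \<in> {1..min DIM('a) DIM('b)}"
  shows "u i - damped_proj A lam (u i) = (lam / ((\<sigma> i)\<^sup>2 + lam)) *\<^sub>R u i"
proof -
  define D where "D = (\<sigma> i)\<^sup>2 + lam"
  have D: "D > 0" using lam by (simp add: D_def add_nonneg_pos)
  note lin = linear_cmul[OF A] linear_cmul[OF adjoint_linear[OF A]]
  note pair = svd_singular_pair[OF A svd i]
  have "(\<sigma> i / D) * (\<sigma> i)\<^sup>2 + lam * (\<sigma> i / D) = \<sigma> i / D * D"
    by (simp add: D_def algebra_simps add_divide_distrib)
  then have "(\<sigma> i / D) * (\<sigma> i)\<^sup>2 + lam * (\<sigma> i / D) = \<sigma> i"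
    using D by simp
  then have "reg_inv A lam (adjoint A (u i)) = (\<sigma> i / D) *\<^sub>R v i"
    by (intro reg_inv_eqI[OF A lam])
       (simp add: lin pair scaleR_add_left[symmetric] power2_eq_square mult.assoc)
  then have "u i - damped_proj A lam (u i) = (1 - (\<sigma> i)\<^sup>2 / D) *\<^sub>R u i"
    by (simp add: damped_proj_def lin pair scaleR_diff_left power2_eq_square)
  also have "1 - (\<sigma> i)\<^sup>2 / D = lam / D"
    using D by (simp add: field_simps D_def)
  finally show ?thesis by (simp add: D_def)
qed

text \<open>The residual map is diagonal in the singular vectors, with factors
  \<open>lam / ((\<sigma> i)\<^sup>2 + lam)\<close> that do not decrease with \<open>i\<close>; on the top \<open>j\<close> of them the factor is
  at most \<open>lam / (\<sigma> j)\<^sup>2\<close>.  The bound \<open>r\<close> on this ratio is given in multiplied form, so that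
  no division by \<open>\<sigma> j\<close> occurs.\<close>

lemma damped_residual_on_top_singular_space:
  fixes A :: "'a::euclidean_space \<Rightarrow> 'b::euclidean_space"
  assumes A: "linear A" and lam: "lam > 0"
    and svd: "is_svd A \<sigma> u v" and j: "j \<in> {1..min DIM('a) DIM('b)}"
    and w: "w \<in> span (u ` {1..j})"
    and r: "lam \<le> r * (\<sigma> j)\<^sup>2" "0 \<le> r"
  shows "norm (w - damped_proj A lam w) \<le> r * norm w"
proof -
  have uu: "\<And>i k. i \<in> {1..j} \<Longrightarrow> k \<in> {1..j} \<Longrightarrow> u i \<bullet> u k = (if i = k then 1 else 0)"
    and mono: "\<And>i. i \<in> {1..j} \<Longrightarrow> \<sigma> j \<le> \<sigma> i" and nonneg: "0 \<le> \<sigma> j"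
    using svd j unfolding is_svd_def by auto
  have inj: "inj_on u {1..j}"
    by (intro inj_onI) (metis uu zero_neq_one)
  obtain c' where "w = (\<Sum>z\<in>u ` {1..j}. c' z *\<^sub>R z)"
    using w by (auto simp: span_finite)
  then have w_eq: "w = (\<Sum>i=1..j. c' (u i) *\<^sub>R u i)"
    unfolding sum.reindex[OF inj] o_def .
  define c where "c i = c' (u i)" for i
  define f where "f i = lam / ((\<sigma> i)\<^sup>2 + lam)" for i
  note lin = linear_damped_proj[OF A lam]
  have "w - damped_proj A lam w = (\<Sum>i=1..j. c i *\<^sub>R (u i - damped_proj A lam (u i)))"
    by (simp add: w_eq c_def linear_sum[OF lin] linear_cmul[OF lin] sum_subtractf
        scaleR_diff_right)
  also have "\<dots> = (\<Sum>i=1..j. (c i * f i) *\<^sub>R u i)"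
    using j by (intro sum.cong refl)
      (simp add: damped_proj_singular_vector[OF A lam svd] f_def)
  finally have "(norm (w - damped_proj A lam w))\<^sup>2 = (\<Sum>i=1..j. (c i * f i)\<^sup>2)"
    using norm_sum_orthonormal[of "{1..j}" u "\<lambda>i. c i * f i"] uu by simp
  also have "\<dots> \<le> (\<Sum>i=1..j. r\<^sup>2 * (c i)\<^sup>2)"
  proof (intro sum_mono)
    fix i assume i: "i \<in> {1..j}"
    have D: "(\<sigma> i)\<^sup>2 + lam > 0" using lam by (simp add: add_nonneg_pos)
    have "lam \<le> r * (\<sigma> i)\<^sup>2"
      using r mono[OF i] nonneg by (meson mult_left_mono order_trans power_mono)
    then have "lam \<le> r * ((\<sigma> i)\<^sup>2 + lam)"
      using r(2) lam by (simp add: distrib_left add_increasing2)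
    then have "f i \<le> r"
      using D by (simp add: f_def pos_divide_le_eq)
    moreover have "0 \<le> f i" using D lam by (simp add: f_def)
    ultimately have "(f i)\<^sup>2 \<le> r\<^sup>2" by (simp add: power_mono)
    then have "(f i)\<^sup>2 * (c i)\<^sup>2 \<le> r\<^sup>2 * (c i)\<^sup>2"
      by (rule mult_right_mono) simp
    then show "(c i * f i)\<^sup>2 \<le> r\<^sup>2 * (c i)\<^sup>2"
      by (simp only: power_mult_distrib mult.commute[of "(c i)\<^sup>2"])
  qed
  also have "\<dots> = (r * norm w)\<^sup>2"
    using norm_sum_orthonormal[of "{1..j}" u c] uu
    by (simp add: w_eq c_def sum_distrib_left power_mult_distrib)
  finally show ?thesis
    by (rule power2_le_imp_le) (use r in simp)
qed

text \<open>Split \<open>e\<close> into its part in the top singular space, which damping changes by a relative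
  amount of at most \<open>lam / (\<sigma> j)\<^sup>2 \<le> \<rho>\<close>, and the rest, which is small by alignment
  and is not enlarged by the residual map.\<close>

lemma damped_residual_of_aligned:
  fixes A :: "'a::euclidean_space \<Rightarrow> 'b::euclidean_space"
  assumes A: "linear A" and lam: "lam > 0"
    and svd: "is_svd A \<sigma> u v" and j: "j \<in> {1..min DIM('a) DIM('b)}"
    and al: "norm (e - orth_proj (span (u ` {1..j})) e) \<le> \<rho> * norm e"
    and rho: "lam \<le> \<rho> * (\<sigma> j)\<^sup>2" "0 \<le> \<rho>"
  shows "norm (e - damped_proj A lam e) \<le> 2 * \<rho> * norm e"
proof -
  define w where "w = orth_proj (span (u ` {1..j})) e"
  note lin = linear_damped_proj[OF A lam]
  have "e - damped_proj A lam e
      = (w - damped_proj A lam w) + ((e - w) - damped_proj A lam (e - w))"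
    by (simp add: linear_diff[OF lin])
  then have "norm (e - damped_proj A lam e)
      \<le> norm (w - damped_proj A lam w) + norm ((e - w) - damped_proj A lam (e - w))"
    by (metis norm_triangle_ineq)
  also have "norm (w - damped_proj A lam w) \<le> \<rho> * norm w"
    by (rule damped_residual_on_top_singular_space[OF A lam svd j _ rho])
       (simp add: w_def orth_proj_properties(1))
  also have "\<rho> * norm w \<le> \<rho> * norm e"
    using rho(2) by (simp add: w_def norm_orth_proj_le mult_left_mono)
  also have "norm ((e - w) - damped_proj A lam (e - w)) \<le> norm (e - w)"
    by (rule norm_damped_residual_le[OF A lam])
  also have "norm (e - w) \<le> \<rho> * norm e"
    using al by (simp add: w_def)
  finally show ?thesis by simp
qed

section \<open>Linearization error\<close>

text \<open>The difference of \<open>F\<close> and its linearization, tested against its own end value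
  \<open>R\<close>, is a scalar function on the segment whose derivative grows at most linearly.
  Subtracting the quadratic with that derivative leaves a nonincreasing function, which gives
  the constant \<open>K / 2\<close>.\<close>

lemma linearization_error_lipschitz_derivative:
  fixes F :: "'a::real_normed_vector \<Rightarrow> 'b::real_inner" and DF :: "'a \<Rightarrow> 'a \<Rightarrow>\<^sub>L 'b"
  assumes deriv: "\<And>y. (F has_derivative DF y) (at y)"
    and lip: "K-lipschitz_on S DF" and S: "convex S" "x \<in> S" "y \<in> S"
  shows "norm (F y - F x - DF x (y - x)) \<le> K / 2 * (norm (y - x))\<^sup>2"
proof -
  define d where "d = y - x"
  define R where "R = F y - F x - DF x d"
  define g where "g t = R \<bullet> (F (x + t *\<^sub>R d) - t *\<^sub>R DF x d)
    - K / 2 * t\<^sup>2 * norm R * (norm d)\<^sup>2" for t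
  define g' where "g' t = R \<bullet> (DF (x + t *\<^sub>R d) d - DF x d)
    - K * t * norm R * (norm d)\<^sup>2" for t
  have "(g has_real_derivative g' t) (at t)" for t
  proof -
    have F': "((\<lambda>t. F (x + t *\<^sub>R d)) has_derivative (\<lambda>h. DF (x + t *\<^sub>R d) (h *\<^sub>R d))) (at t)"
      by (rule has_derivative_compose[of "\<lambda>t. x + t *\<^sub>R d", OF _ deriv])
         (auto intro!: derivative_eq_intros)
    show ?thesis
      unfolding g_def g'_def has_field_derivative_def
      by (rule derivative_eq_intros F' refl)+
         (auto simp: blinfun.scaleR_right algebra_simps fun_eq_iff)
  qed
  moreover have "g' t \<le> 0" if t: "0 \<le> t" "t \<le> 1" for t
  proof -
    have "x + t *\<^sub>R d = (1 - t) *\<^sub>R x + t *\<^sub>R y"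
      by (simp add: d_def algebra_simps)
    then have "x + t *\<^sub>R d \<in> S"
      using convexD[OF S, of "1 - t" t] t by simp
    then have "norm (DF (x + t *\<^sub>R d) - DF x) \<le> K * norm (t *\<^sub>R d)"
      using lipschitz_on_normD[OF lip, of "x + t *\<^sub>R d" x] S by simp
    moreover have "norm (DF (x + t *\<^sub>R d) d - DF x d) \<le> norm (DF (x + t *\<^sub>R d) - DF x) * norm d"
      using norm_blinfun[of "DF (x + t *\<^sub>R d) - DF x" d] by (simp add: blinfun.diff_left)
    ultimately have "norm (DF (x + t *\<^sub>R d) d - DF x d) \<le> K * (t * norm d) * norm d"
      using t by (smt (verit) abs_of_nonneg mult_right_mono norm_ge_zero norm_scaleR)
    then have "norm R * norm (DF (x + t *\<^sub>R d) d - DF x d) \<le> norm R * (K * (t * norm d) * norm d)"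
      by (rule mult_left_mono) simp
    then show ?thesis
      using norm_cauchy_schwarz[of R "DF (x + t *\<^sub>R d) d - DF x d"]
      by (simp add: g'_def power2_eq_square algebra_simps)
  qed
  ultimately have "g 1 \<le> g 0"
    by (intro DERIV_nonpos_imp_nonincreasing[of 0 1 g]) auto
  then have "R \<bullet> R \<le> K / 2 * norm R * (norm d)\<^sup>2"
    by (simp add: g_def R_def d_def inner_diff_right)
  then have "norm R * norm R \<le> norm R * (K / 2 * (norm d)\<^sup>2)"
    by (simp add: power2_norm_eq_inner[symmetric] power2_eq_square algebra_simps)
  moreover have "0 \<le> K / 2 * (norm d)\<^sup>2"
    using lipschitz_on_nonneg[OF lip] by simp
  ultimately show ?thesis
    unfolding R_def d_def[symmetric]
    by (smt (verit) mult_le_cancel_left_pos norm_ge_zero)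
qed

section \<open>One step of the method\<close>

text \<open>Write \<open>P\<close> for the damped projection, \<open>p\<close> for the projection of the subgradient \<open>v\<close>
  onto the range of \<open>A\<close>, \<open>\<Delta>\<close> for the gap in function value and \<open>a = \<Delta> / norm p\<close>.  Since
  \<open>P\<close> nearly fixes \<open>e\<close>, \<open>v \<bullet> P e\<close> keeps at least \<open>3/4\<close> of \<open>v \<bullet> e \<ge> \<Delta>\<close>.
  Hence \<open>a \<le> 4/3 * norm e\<close>; with \<open>lam * norm (t * d) ^ 2 \<le> (\<gamma> * a) ^ 2 / 4\<close> this bounds
  the step.  Expanding the square gives
  \<open>norm (e - t * P v) ^ 2 \<le> norm e ^ 2 - \<gamma> * a ^ 2 / 2\<close>, a decrease of the norm by at least
  \<open>\<gamma> * a ^ 2 / (4 * norm e)\<close>.  The quadratic error costs at most half of it because \<open>\<gamma> * K \<le> C\<close>, and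
  \<open>a \<ge> \<mu> * norm e / L\<close> turns the remaining half into the contraction factor.\<close>

lemma polyak_step_estimates:
  fixes A :: "'a::euclidean_space \<Rightarrow> 'b::euclidean_space"
  assumes A: "linear A" and lam: "lam > 0"
    and pos: "0 < \<mu>" "0 < L" "0 < \<gamma>" "\<gamma> \<le> 1" "0 < C" "0 \<le> K"
    and gap: "\<mu> * norm e \<le> \<Delta>" "\<Delta> \<le> v \<bullet> e"
    and proj: "norm (orth_proj (range A) v) \<le> L"
    and res: "\<bar>v \<bullet> (e - damped_proj A lam e)\<bar> \<le> L * norm (e - damped_proj A lam e)"
      "norm (e - damped_proj A lam e) \<le> \<mu> / (4 * L) * norm e"
    and t: "t = \<gamma> * (\<Delta> / (norm (orth_proj (range A) v))\<^sup>2)" "0 < t"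
    and lam_ge: "C * norm e \<le> lam" and K: "\<gamma> * K \<le> C"
    and d: "d = reg_inv A lam (adjoint A v)"
  shows "norm (t *\<^sub>R d) \<le> 2 / 3 * \<gamma> * sqrt (norm e / C)"
    and "norm (e - t *\<^sub>R A d) + K / 2 * (norm (t *\<^sub>R d))\<^sup>2 \<le> (1 - \<gamma> * \<mu>\<^sup>2 / (8 * L\<^sup>2)) * norm e"
    and "0 < norm e"
proof -
  define n where "n = norm (orth_proj (range A) v)"
  define a where "a = \<Delta> / n"
  define E where "E = norm e"
  have "n \<noteq> 0" using t by (auto simp: n_def)
  then have n: "n > 0" by (simp add: n_def)
  have "0 < \<Delta>" using t pos n by (simp add: n_def zero_less_mult_iff zero_less_divide_iff)
  then have "e \<noteq> 0" using gap by auto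
  then have E: "E > 0" by (simp add: E_def)
  then show "0 < norm e" by (simp add: E_def)
  have a: "a > 0" using \<open>0 < \<Delta>\<close> n by (simp add: a_def)
  have tn: "t * n = \<gamma> * a" using n by (simp add: t n_def a_def power2_eq_square)
  have tD: "t * \<Delta> = \<gamma> * a\<^sup>2" using n by (simp add: t n_def a_def power2_eq_square)
  have Ad: "A d = damped_proj A lam v" by (simp add: d damped_proj_def)

  have "v \<bullet> (e - damped_proj A lam e) \<le> L * (\<mu> / (4 * L) * E)"
    using res pos(2) unfolding E_def by (smt (verit) mult_left_mono)
  also have "\<dots> \<le> \<Delta> / 4" using gap(1) pos by (simp add: E_def)
  finally have vPe: "3 / 4 * \<Delta> \<le> A d \<bullet> e"
    using gap(2) by (simp add: Ad damped_proj_self_adjoint[OF A lam] inner_diff_right)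
  have Pv: "norm (A d) \<le> n"
    unfolding Ad n_def by (rule norm_damped_proj_le[OF A lam])
  have "A d \<bullet> e \<le> norm (A d) * E"
    unfolding E_def by (rule norm_cauchy_schwarz)
  also have "\<dots> \<le> n * E" using Pv E by simp
  finally have a_le: "a \<le> 4 / 3 * E"
    using vPe n by (simp add: a_def field_simps)

  have "lam * (norm d)\<^sup>2 \<le> n\<^sup>2 / 4"
    unfolding d n_def by (rule norm_reg_inv_le[OF A lam])
  then have "t\<^sup>2 * (lam * (norm d)\<^sup>2) \<le> t\<^sup>2 * (n\<^sup>2 / 4)"
    by (rule mult_left_mono) simp
  also have "\<dots> = (\<gamma> * a)\<^sup>2 / 4" by (simp add: tn[symmetric] power_mult_distrib)
  finally have "lam * (norm (t *\<^sub>R d))\<^sup>2 \<le> (\<gamma> * a)\<^sup>2 / 4"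
    by (simp add: power_mult_distrib algebra_simps)
  moreover have "C * E * (norm (t *\<^sub>R d))\<^sup>2 \<le> lam * (norm (t *\<^sub>R d))\<^sup>2"
    using lam_ge by (intro mult_right_mono) (auto simp: E_def)
  ultimately have step: "C * E * (norm (t *\<^sub>R d))\<^sup>2 \<le> (\<gamma> * a)\<^sup>2 / 4" by linarith

  show "norm (t *\<^sub>R d) \<le> 2 / 3 * \<gamma> * sqrt (norm e / C)"
  proof (rule power2_le_imp_le)
    have "(\<gamma> * a)\<^sup>2 \<le> (\<gamma> * (4 / 3 * E))\<^sup>2"
      using a_le a pos by (intro power_mono mult_left_mono) auto
    also have "\<dots> = 4 * (E * (4 / 9 * \<gamma>\<^sup>2 * E))"
      by (simp add: power2_eq_square)
    finally have "E * (C * (norm (t *\<^sub>R d))\<^sup>2) \<le> E * (4 / 9 * \<gamma>\<^sup>2 * E)"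
      using step unfolding mult.assoc mult.left_commute[of C E] by linarith
    then have "C * (norm (t *\<^sub>R d))\<^sup>2 \<le> 4 / 9 * \<gamma>\<^sup>2 * E"
      using E by (rule mult_left_le_imp_le)
    then have "(norm (t *\<^sub>R d))\<^sup>2 \<le> 4 / 9 * \<gamma>\<^sup>2 * (E / C)"
      using pos by (simp add: field_simps)
    also have "\<dots> = (2 / 3 * \<gamma> * sqrt (norm e / C))\<^sup>2"
      using E pos by (simp add: power_mult_distrib power_divide E_def)
    finally show "(norm (t *\<^sub>R d))\<^sup>2 \<le> (2 / 3 * \<gamma> * sqrt (norm e / C))\<^sup>2" .
  qed (use pos E in \<open>simp add: E_def\<close>)

  have expand: "(norm (e - t *\<^sub>R A d))\<^sup>2 = E\<^sup>2 - 2 * t * (A d \<bullet> e) + (t * norm (A d))\<^sup>2"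
    unfolding E_def power_mult_distrib power2_norm_eq_inner
    by (simp add: inner_diff_left inner_diff_right inner_commute power2_eq_square algebra_simps)
  have "2 * t * (3 / 4 * \<Delta>) \<le> 2 * t * (A d \<bullet> e)"
    using vPe t(2) by (intro mult_left_mono) auto
  then have linear_gain: "3 / 2 * (\<gamma> * a\<^sup>2) \<le> 2 * t * (A d \<bullet> e)"
    by (simp add: tD[symmetric] mult.commute)
  have "(t * norm (A d))\<^sup>2 \<le> (t * n)\<^sup>2"
    using Pv t(2) by (intro power_mono mult_left_mono) auto
  also have "\<dots> = \<gamma> * (\<gamma> * a\<^sup>2)" by (simp add: tn power2_eq_square)
  also have "\<dots> \<le> \<gamma> * a\<^sup>2"
    using pos by (simp add: mult_left_le_one_le)
  finally have sq: "(norm (e - t *\<^sub>R A d))\<^sup>2 \<le> E\<^sup>2 - \<gamma> * a\<^sup>2 / 2"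
    using expand linear_gain by linarith

  define b where "b = \<gamma> * a\<^sup>2 / (4 * E)"
  have b: "\<gamma> * a\<^sup>2 = 4 * (E * b)" using E by (simp add: b_def)
  have main: "norm (e - t *\<^sub>R A d) \<le> E - b"
  proof (rule power2_le_imp_le)
    show "(norm (e - t *\<^sub>R A d))\<^sup>2 \<le> (E - b)\<^sup>2"
      using sq b zero_le_power2[of b] unfolding power2_diff mult.assoc[of 2] by linarith
    have "0 \<le> E\<^sup>2 - \<gamma> * a\<^sup>2 / 2" using sq by (rule order_trans[rotated]) simp
    then have "0 \<le> E * (E - 2 * b)" unfolding b by (simp add: power2_eq_square algebra_simps)
    then have "0 \<le> E - 2 * b" using E by (simp add: zero_le_mult_iff)
    moreover have "0 \<le> b" using pos E by (simp add: b_def)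
    ultimately show "0 \<le> E - b" by linarith
  qed
  have err: "K / 2 * (norm (t *\<^sub>R d))\<^sup>2 \<le> b / 2"
  proof -
    have "\<gamma> * K * (E * (norm (t *\<^sub>R d))\<^sup>2) \<le> C * (E * (norm (t *\<^sub>R d))\<^sup>2)"
      using K E by (intro mult_right_mono) auto
    then have "(\<gamma> * E) * (K * (norm (t *\<^sub>R d))\<^sup>2) \<le> (\<gamma> * E) * b"
      using step b by (simp add: power2_eq_square algebra_simps)
    then show ?thesis using pos E by simp
  qed
  have half: "\<gamma> * \<mu>\<^sup>2 / (8 * L\<^sup>2) * E \<le> b / 2"
  proof -
    have "n \<le> L" using proj by (simp add: n_def)
    then have "n * a \<le> L * a" using a by simp
    moreover have "n * a = \<Delta>" using n by (simp add: a_def)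
    ultimately have "\<mu> * E / L \<le> a"
      using gap(1) pos by (simp add: E_def field_simps)
    then have "\<gamma> * (\<mu> * E / L)\<^sup>2 \<le> \<gamma> * a\<^sup>2"
      using pos E by (intro mult_left_mono power_mono) auto
    then have "(\<gamma> * \<mu>\<^sup>2 / L\<^sup>2 * E) * E \<le> (4 * b) * E"
      using b by (simp add: power_mult_distrib power_divide power2_eq_square mult_ac)
    then have bound: "\<gamma> * \<mu>\<^sup>2 / L\<^sup>2 * E \<le> 4 * b"
      using E by (rule mult_right_le_imp_le)
    have "\<gamma> * \<mu>\<^sup>2 / (8 * L\<^sup>2) * E = (\<gamma> * \<mu>\<^sup>2 / L\<^sup>2 * E) / 8" by simp
    also have "\<dots> \<le> 4 * b / 8" by (rule divide_right_mono[OF bound]) simp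
    finally show ?thesis by simp
  qed
  show "norm (e - t *\<^sub>R A d) + K / 2 * (norm (t *\<^sub>R d))\<^sup>2 \<le> (1 - \<gamma> * \<mu>\<^sup>2 / (8 * L\<^sup>2)) * norm e"
  proof -
    have "norm (e - t *\<^sub>R A d) + K / 2 * (norm (t *\<^sub>R d))\<^sup>2 \<le> (E - b) + b / 2"
      by (rule add_mono[OF main err])
    also have "\<dots> = E - b / 2" by simp
    also have "\<dots> \<le> E - \<gamma> * \<mu>\<^sup>2 / (8 * L\<^sup>2) * E"
      using half by (rule diff_left_mono)
    also have "\<dots> = (1 - \<gamma> * \<mu>\<^sup>2 / (8 * L\<^sup>2)) * norm e"
      by (simp only: E_def left_diff_distrib mult_1_left)
    finally show ?thesis .
  qed
qed

section \<open>Convergence\<close>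

lemma min_val_eq:
  assumes "zstar \<in> minimizers h F"
  shows "min_val h F = h zstar"
  unfolding min_val_def
  by (rule cInf_eq_minimum)
     (use assms in \<open>auto simp: minimizers_def is_arg_min_def not_less\<close>)

theorem theorem4p7:
  fixes h :: "'b::euclidean_space \<Rightarrow> real"
    and F :: "'a::euclidean_space \<Rightarrow> 'b"
    and DF :: "'a \<Rightarrow> 'a \<Rightarrow>\<^sub>L 'b"
    and \<sigma> :: "'a \<Rightarrow> nat \<Rightarrow> real"
    and U :: "'a \<Rightarrow> nat \<Rightarrow> 'b"
    and V :: "'a \<Rightarrow> nat \<Rightarrow> 'a"
    and xstar :: 'a and zstar :: 'b
    and \<mu> L L_DF eps_DF eps_x eps \<gamma> Clb Cub q :: real
    and \<delta> s :: "real \<Rightarrow> real"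
    and step damp :: "nat \<Rightarrow> real"
    and v :: "nat \<Rightarrow> 'b"
    and x :: "nat \<Rightarrow> 'a"
  assumes h_convex: "convex_on UNIV h"
    and F_deriv: "\<And>y. (F has_derivative DF y) (at y)"
    and DF_cont: "continuous_on UNIV DF"
    and svd: "\<And>y. is_svd (DF y) (\<sigma> y) (U y) (V y)"
    and xstar: "is_arg_min (\<lambda>y. h (F y)) (\<lambda>y. True) xstar"
    and zstar: "zstar = F xstar"
    and regular: "nonsmooth_regular h F DF zstar \<mu> L"
    and eps_DF: "eps_DF > 0"
    and DF_lipschitz: "L_DF-lipschitz_on (cball xstar eps_DF) DF"
    and aligned: "locally_weakly_aligned F \<sigma> U xstar \<delta> s eps_x"
    and eps: "eps = min eps_DF eps_x"
    and gamma_pos: "\<gamma> > 0"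
    and Clb_pos: "0 < Clb"
    and Clb_Cub: "Clb \<le> Cub"
    and gamma_le: "ereal \<gamma> \<le> min 1 (ereal Clb / ereal L_DF)"
    and Cub_le: "Cub \<le> \<mu> / (8 * L) * s (\<mu> / (8 * L))"
    and q: "q = sqrt (1 - \<gamma> * \<mu>\<^sup>2 / (8 * L\<^sup>2))"
    and x0: "norm (x 0 - xstar) \<le> eps / 2"
    and z0: "norm (F (x 0) - zstar)
               \<le> min (\<delta> (\<mu> / (8 * L))) ((1 - sqrt q)\<^sup>2 * eps\<^sup>2 * Clb / (2 * \<gamma>\<^sup>2))"
    and lmm: "lmm_subgradient h F DF step damp v x"
    and polyak: "polyak_config h F DF \<gamma> Clb Cub step damp v x"
  shows "(\<forall>k. norm (x k - xstar) < eps) \<and>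
    (\<forall>k. (norm (F (x k) - zstar))\<^sup>2
           \<le> (1 - \<gamma> * \<mu>\<^sup>2 / (8 * L\<^sup>2)) ^ k * (norm (F (x 0) - zstar))\<^sup>2)"
proof -
  define \<rho> where "\<rho> = \<mu> / (8 * L)"
  define \<kappa> where "\<kappa> = \<gamma> * \<mu>\<^sup>2 / (8 * L\<^sup>2)"
  define e where "e k = F (x k) - zstar" for k
  define P where "P k = damped_proj (DF (x k)) (damp k)" for k
  define d where "d k = reg_inv (DF (x k)) (damp k) (adjoint (DF (x k)) (v k))" for k
  have lin: "linear (blinfun_apply B)" for B :: "'a \<Rightarrow>\<^sub>L 'b"
    by (simp add: blinfun.bounded_linear_right bounded_linear.linear)
  have min: "minimizers h F = {zstar}" and mu: "\<mu> > 0" and L: "L > 0"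
    and sharp: "\<And>z. z \<in> range F \<Longrightarrow> \<mu> * norm (z - zstar) \<le> h z - min_val h F"
    and proj: "\<And>y w. w \<in> subdiff h (F y) \<Longrightarrow> norm (orth_proj (range (DF y)) w) \<le> L"
    and res: "\<And>y w lam. w \<in> subdiff h (F y) \<Longrightarrow> lam > 0 \<Longrightarrow>
        \<bar>w \<bullet> ((F y - zstar) - damped_proj (DF y) lam (F y - zstar))\<bar>
          \<le> L * norm ((F y - zstar) - damped_proj (DF y) lam (F y - zstar))"
    using regular unfolding nonsmooth_regular_def by auto
  have step: "step k > 0" "damp k > 0" "v k \<in> subdiff h (F (x k))"
    "x (Suc k) = x k - step k *\<^sub>R d k" for k
    using lmm unfolding lmm_subgradient_def d_def by auto
  have config: "step k = \<gamma> * ((h (F (x k)) - h zstar) / (norm (orth_proj (range (DF (x k))) (v k)))\<^sup>2)"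
    "Clb * norm (e k) \<le> damp k" "damp k \<le> Cub * norm (e k)" for k
    using polyak unfolding polyak_config_def
    by (auto simp: min min_val_eq[of zstar] e_def dist_norm)
  have rho: "\<rho> > 0" using mu L by (simp add: \<rho>_def)
  have K: "0 \<le> L_DF" using DF_lipschitz by (rule lipschitz_on_nonneg)
  have g1: "\<gamma> \<le> 1" using gamma_le by (simp add: min.bounded_iff one_ereal_def)
  have gK: "\<gamma> * L_DF \<le> Clb"
  proof (cases "L_DF = 0")
    case False
    then show ?thesis using gamma_le K by (simp add: field_simps)
  qed (use Clb_pos in simp)
  have eps_pos: "eps > 0"
    using aligned eps eps_DF by (auto simp: locally_weakly_aligned_def)

  have nearby: "norm (step k *\<^sub>R d k) \<le> 2 / 3 * \<gamma> * sqrt (norm (e k) / Clb) \<and>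
      norm (e k - step k *\<^sub>R DF (x k) (d k)) + L_DF / 2 * (norm (step k *\<^sub>R d k))\<^sup>2
        \<le> (1 - \<kappa>) * norm (e k) \<and> 0 < norm (e k)"
    if xk: "norm (x k - xstar) \<le> eps" and zk: "norm (e k) \<le> \<delta> \<rho>" for k
  proof -
    obtain j where j: "j \<in> {1..min DIM('a) DIM('b)}"
      and al: "norm (e k - orth_proj (span (U (x k) ` {1..j})) (e k)) \<le> \<rho> * norm (e k)"
      and sj: "(\<sigma> (x k) j)\<^sup>2 \<ge> s \<rho> * norm (e k)"
    proof -
      have "x k \<in> cball xstar eps_x" and "F (x k) \<in> cball (F xstar) (\<delta> \<rho>)"
        using xk zk eps zstar by (auto simp: dist_norm norm_minus_commute e_def)
      then show ?thesis
        using aligned rho that zstar unfolding locally_weakly_aligned_def e_def by blast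
    qed
    have "damp k \<le> \<rho> * s \<rho> * norm (e k)"
      using config(3)[of k] Cub_le unfolding \<rho>_def
      by (meson mult_right_mono norm_ge_zero order_trans)
    also have "\<dots> \<le> \<rho> * (\<sigma> (x k) j)\<^sup>2"
      using sj rho by (simp add: mult.assoc)
    finally have "norm (e k - P k (e k)) \<le> 2 * \<rho> * norm (e k)"
      unfolding P_def using rho
      by (intro damped_residual_of_aligned[OF lin step(2) svd j al]) auto
    then have r: "norm (e k - P k (e k)) \<le> \<mu> / (4 * L) * norm (e k)"
      by (simp add: \<rho>_def)
    have gap: "\<mu> * norm (e k) \<le> h (F (x k)) - h zstar" "h (F (x k)) - h zstar \<le> v k \<bullet> e k"
    proof -
      show "\<mu> * norm (e k) \<le> h (F (x k)) - h zstar"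
        using sharp[of "F (x k)"] by (simp add: e_def min min_val_eq[of zstar])
      have "h zstar \<ge> h (F (x k)) + v k \<bullet> (zstar - F (x k))"
        using step(3)[of k] by (simp add: subdiff_def)
      then show "h (F (x k)) - h zstar \<le> v k \<bullet> e k"
        by (simp add: e_def inner_diff_right)
    qed
    note est = polyak_step_estimates[OF lin step(2) mu L gamma_pos g1 Clb_pos K gap
        proj[OF step(3)] res[OF step(3) step(2), of k, folded e_def] r[unfolded P_def]
        config(1) step(1) config(2) gK d_def]
    show ?thesis using est by (simp add: \<kappa>_def)
  qed

  have z0': "norm (e 0) \<le> \<delta> \<rho>"
    and z0'': "norm (e 0) \<le> (1 - sqrt q)\<^sup>2 * eps\<^sup>2 * Clb / (2 * \<gamma>\<^sup>2)"
    using z0 by (auto simp: e_def \<rho>_def)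
  have kpos: "\<kappa> > 0" using mu L gamma_pos by (simp add: \<kappa>_def)
  \<comment> \<open>The first contraction estimate already forces \<open>\<kappa> \<le> 1\<close>: its left-hand side is a norm.\<close>
  have k1: "\<kappa> \<le> 1"
  proof -
    have "norm (x 0 - xstar) \<le> eps" using x0 eps_pos by simp
    note near = nearby[OF this z0']
    have "0 \<le> L_DF / 2 * (norm (step 0 *\<^sub>R d 0))\<^sup>2" using K by simp
    then have "0 \<le> (1 - \<kappa>) * norm (e 0)" and "0 < norm (e 0)"
      using near norm_ge_zero[of "e 0 - step 0 *\<^sub>R DF (x 0) (d 0)"] by linarith+
    then show ?thesis by (simp add: zero_le_mult_iff)
  qed
  have q': "q = sqrt (1 - \<kappa>)" using q by (simp add: \<kappa>_def)
  have q01: "0 \<le> q" "q < 1" using kpos k1 by (auto simp: q')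
  have kq: "1 - \<kappa> \<le> q"
    using kpos k1 mult_left_le[of "1 - \<kappa>" "1 - \<kappa>"]
    unfolding q' by (intro real_le_rsqrt) (simp add: power2_eq_square)
  define r where "r = sqrt q"
  have r01: "0 \<le> r" "r < 1" using q01 by (auto simp: r_def)
  \<comment> \<open>\<open>c * r ^ k\<close> bounds the length of step \<open>k\<close>, and \<open>c < (1 - r) * eps / 2\<close>
    keeps the whole path shorter than \<open>eps / 2\<close>.\<close>
  define c where "c = 2 / 3 * \<gamma> * sqrt (norm (e 0) / Clb)"
  have c0: "0 \<le> c" using gamma_pos Clb_pos by (simp add: c_def)
  have c: "c < (1 - r) * eps / 2"
  proof (rule power2_less_imp_less)
    have "c\<^sup>2 = 4 / 9 * \<gamma>\<^sup>2 * (norm (e 0) / Clb)"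
      using Clb_pos by (simp add: c_def power_mult_distrib power_divide)
    also have "\<dots> \<le> 4 / 9 * \<gamma>\<^sup>2 * ((1 - r)\<^sup>2 * eps\<^sup>2 / (2 * \<gamma>\<^sup>2))"
      using z0'' Clb_pos gamma_pos
      by (intro mult_left_mono) (auto simp: r_def field_simps)
    also have "\<dots> = 2 / 9 * ((1 - r) * eps)\<^sup>2"
      using gamma_pos by (simp add: power_mult_distrib)
    also have "\<dots> < ((1 - r) * eps / 2)\<^sup>2"
    proof -
      have "0 < (1 - r) * eps" using r01 eps_pos by simp
      then have "0 < ((1 - r) * eps)\<^sup>2" by (rule zero_less_power)
      then show ?thesis unfolding power_divide[of _ 2] by (simp only: power2_eq_square[of "2::real"])
    qed
    finally show "c\<^sup>2 < ((1 - r) * eps / 2)\<^sup>2" .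
  qed (use r01 eps_pos in simp)
  have total: "eps / 2 + c * (\<Sum>i<k. r ^ i) < eps" for k
  proof -
    have "(\<Sum>i<k. r ^ i) = (1 - r ^ k) / (1 - r)"
      using r01 by (simp add: sum_gp_strict)
    also have "\<dots> \<le> 1 / (1 - r)"
      using r01 by (intro divide_right_mono) auto
    finally have "c * (\<Sum>i<k. r ^ i) \<le> c / (1 - r)"
      using c0 mult_left_mono by fastforce
    also have "\<dots> < eps / 2"
      using c r01 by (simp add: field_simps)
    finally show ?thesis by simp
  qed

  \<comment> \<open>Both bounds go through one induction: the step estimates at \<open>k\<close> require \<open>x k\<close> near
    \<open>xstar\<close> and \<open>F (x k)\<close> near \<open>zstar\<close>, and the linearization bound also requires
    \<open>x (Suc k)\<close> in the ball, which is therefore shown first.\<close>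
  have inv: "norm (x k - xstar) \<le> eps / 2 + c * (\<Sum>i<k. r ^ i) \<and>
      norm (e k) \<le> q ^ k * norm (e 0)" for k
  proof (induction k)
    case 0
    then show ?case using x0 by simp
  next
    case (Suc k)
    have xk: "norm (x k - xstar) \<le> eps" using Suc total[of k] by simp
    have "q ^ k \<le> 1" using q01 by (simp add: power_le_one)
    then have "norm (e k) \<le> \<delta> \<rho>"
      using Suc z0' by (smt (verit) mult_left_le_one_le norm_ge_zero q01(1) zero_le_power)
    note near = nearby[OF xk this]
    have "sqrt (norm (e k) / Clb) \<le> sqrt (q ^ k * (norm (e 0) / Clb))"
      using Suc Clb_pos by (simp add: divide_right_mono)
    also have "\<dots> = r ^ k * sqrt (norm (e 0) / Clb)"
      unfolding r_def by (simp only: real_sqrt_mult real_sqrt_power)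
    finally have "2 / 3 * \<gamma> * sqrt (norm (e k) / Clb)
        \<le> 2 / 3 * \<gamma> * (r ^ k * sqrt (norm (e 0) / Clb))"
      using gamma_pos by (intro mult_left_mono) auto
    also have "\<dots> = c * r ^ k" by (simp add: c_def)
    finally have "2 / 3 * \<gamma> * sqrt (norm (e k) / Clb) \<le> c * r ^ k" .
    then have sk: "norm (step k *\<^sub>R d k) \<le> c * r ^ k"
      using near by linarith
    have "norm (x (Suc k) - xstar) \<le> norm (x k - xstar) + norm (step k *\<^sub>R d k)"
      using norm_triangle_ineq4[of "x k - xstar" "step k *\<^sub>R d k"]
      by (simp add: step(4) algebra_simps)
    then have x1: "norm (x (Suc k) - xstar) \<le> eps / 2 + c * (\<Sum>i<Suc k. r ^ i)"
      using sk Suc by (simp add: algebra_simps)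
    define R where "R = F (x (Suc k)) - F (x k) - DF (x k) (x (Suc k) - x k)"
    have "norm (x (Suc k) - xstar) \<le> eps" using x1 total[of "Suc k"] by linarith
    then have R: "norm R \<le> L_DF / 2 * (norm (step k *\<^sub>R d k))\<^sup>2"
      using linearization_error_lipschitz_derivative[OF F_deriv DF_lipschitz convex_cball,
          of "x k" "x (Suc k)"] xk eps
      by (simp add: R_def dist_norm norm_minus_commute step(4))
    have "e (Suc k) = (e k - step k *\<^sub>R DF (x k) (d k)) + R"
      by (simp add: R_def e_def step(4) blinfun.scaleR_right blinfun.minus_right)
    then have "norm (e (Suc k)) \<le> norm (e k - step k *\<^sub>R DF (x k) (d k)) + norm R"
      by (metis norm_triangle_ineq)
    also have "\<dots> \<le> (1 - \<kappa>) * norm (e k)" using near R by linarith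
    also have "\<dots> \<le> q * norm (e k)" using kq by (simp add: mult_right_mono)
    also have "\<dots> \<le> q * (q ^ k * norm (e 0))" using Suc q01 by (simp add: mult_left_mono)
    finally show ?case using x1 by (simp add: mult.assoc)
  qed
  show ?thesis
  proof (intro conjI allI)
    fix k
    show "norm (x k - xstar) < eps" using inv[of k] total[of k] by linarith
    have "(norm (e k))\<^sup>2 \<le> (q ^ k * norm (e 0))\<^sup>2"
      using inv[of k] by (intro power_mono) auto
    also have "\<dots> = (q\<^sup>2) ^ k * (norm (e 0))\<^sup>2"
      by (simp add: power_mult_distrib power_even_eq power_mult[symmetric] mult.commute)
    also have "q\<^sup>2 = 1 - \<kappa>" using k1 by (simp add: q')
    finally show "(norm (F (x k) - zstar))\<^sup>2
        \<le> (1 - \<gamma> * \<mu>\<^sup>2 / (8 * L\<^sup>2)) ^ k * (norm (F (x 0) - zstar))\<^sup>2"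
      by (simp add: e_def \<kappa>_def)
  qed
qed

end
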